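(* Let $\mathbf u_1,\ldots,\mathbf u_n$ be arbitrary nonzero vectors in $\mathbb R^n$ (not necessarily linearly independent), let $L$ be any linear subspace of $\mathbb R^n$ with orthogonal projection $Q$, and let $\lambda$ be any real number. With $A_i,B_i,H_i,M$ as defined in the context, $$\sum_{i=1}^{n}\frac{B_iH_i^{2}}{SA_i^{2}}=n\lambda^{2}+(1-2\lambda)\operatorname{tr}(QM).$$
   Context: The point $S$ is identified with the origin of Euclidean space $\mathbb R^n$. Given nonzero vectors $\mathbf u_1,\ldots,\mathbf u_n\in\mathbb R^n$, put $A_i=S+\mathbf u_i$ (so $SA_i=\lVert\mathbf u_i\rVert$), $\mathbf e_i=\mathbf u_i/\lVert\mathbf u_i\rVert$, and $M=\sum_{i=1}^n\mathbf e_i\mathbf e_i^{\mathsf T}$ (an $n\times n$ matrix, the frame operator). For a linear subspace $L$, $Q$ is the orthogonal projection of $\mathbb R^n$ onto $L$, $H_i$ is the orthogonal projection of $A_i$ onto $L$ (so $\overrightarrow{SH_i}=Q\mathbf u_i$), and for real $\lambda$ the point $B_i$ is defined by $\overrightarrow{SB_i}=\lambda\mathbf u_i$. For points $X,Y$, $XY$ denotes their Euclidean distance. *)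

theory Defs
  imports "HOL-Analysis.Analysis"
begin

text \<open>
  The n vectors in n-dimensional space are a family \<open>u :: 'n \<Rightarrow> real ^ 'n\<close>: the finite type
  \<open>'n\<close> indexes both the vectors and the coordinates, and n is \<open>CARD('n)\<close>.
\<close>

definition orth_proj :: "(real ^ 'n) set \<Rightarrow> real ^ 'n \<Rightarrow> real ^ 'n" where
  "orth_proj L x = (THE y. y \<in> L \<and> (\<forall>z\<in>L. orthogonal (x - y) z))"

lemma orth_proj_ex1:
  fixes L :: "(real ^ 'n) set"
  assumes "subspace L"
  shows "\<exists>!y. y \<in> L \<and> (\<forall>z\<in>L. orthogonal (x - y) z)"
proof -
  have span: "span L = L"
    using assms by simp
  obtain y w where y: "y \<in> span L" and w: "\<And>z. z \<in> span L \<Longrightarrow> orthogonal w z" and x: "x = y + w"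
    by (rule orthogonal_subspace_decomp_exists[of L x]) blast
  show ?thesis
  proof (rule ex1I[of _ y])
    show "y \<in> L \<and> (\<forall>z\<in>L. orthogonal (x - y) z)"
      using y w x span by auto
  next
    fix y' assume y': "y' \<in> L \<and> (\<forall>z\<in>L. orthogonal (x - y') z)"
    have "y' - y \<in> L"
      using y y' span assms by (simp add: subspace_diff)
    then have "orthogonal (x - y') (y' - y)" "orthogonal w (y' - y)"
      using y' w span by auto
    then have "(y' - y) \<bullet> (y' - y) = 0"
      by (simp add: x orthogonal_def algebra_simps)
    then show "y' = y" by simp
  qed
qed

lemma orth_proj_works:
  assumes "subspace L"
  shows "orth_proj L x \<in> L" "z \<in> L \<Longrightarrow> orthogonal (x - orth_proj L x) z"
  using theI'[OF orth_proj_ex1[OF assms, of x]] unfolding orth_proj_def by auto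

lemma orth_proj_eqI:
  assumes "subspace L" "y \<in> L" "\<And>z. z \<in> L \<Longrightarrow> orthogonal (x - y) z"
  shows "orth_proj L x = y"
  unfolding orth_proj_def by (rule the1_equality[OF orth_proj_ex1[OF assms(1)]]) (simp add: assms)

lemma linear_orth_proj:
  assumes "subspace L"
  shows "linear (orth_proj L)"
proof (rule linearI)
  fix x y
  show "orth_proj L (x + y) = orth_proj L x + orth_proj L y"
  proof (rule orth_proj_eqI[OF assms])
    show "orth_proj L x + orth_proj L y \<in> L"
      by (simp add: assms orth_proj_works subspace_add)
    fix z assume "z \<in> L"
    then show "orthogonal (x + y - (orth_proj L x + orth_proj L y)) z"
      using orth_proj_works(2)[OF assms, of z x] orth_proj_works(2)[OF assms, of z y]
      by (simp add: orthogonal_def algebra_simps)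
  qed
next
  fix c x
  show "orth_proj L (c *\<^sub>R x) = c *\<^sub>R orth_proj L x"
  proof (rule orth_proj_eqI[OF assms])
    show "c *\<^sub>R orth_proj L x \<in> L"
      by (simp add: assms orth_proj_works subspace_scale)
    fix z assume "z \<in> L"
    then show "orthogonal (c *\<^sub>R x - c *\<^sub>R orth_proj L x) z"
      using orth_proj_works(2)[OF assms, of z x]
      by (simp add: orthogonal_def algebra_simps)
  qed
qed

definition proj_matrix :: "(real ^ 'n) set \<Rightarrow> real ^ 'n ^ 'n" where
  "proj_matrix L = matrix (orth_proj L)"

definition unit_dir :: "('n \<Rightarrow> real ^ 'n) \<Rightarrow> 'n \<Rightarrow> real ^ 'n" where
  "unit_dir u i = u i /\<^sub>R norm (u i)"

definition frame_operator :: "('n::finite \<Rightarrow> real ^ 'n) \<Rightarrow> real ^ 'n ^ 'n" where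
  "frame_operator u =
    (\<Sum>i\<in>UNIV. (columnvector (unit_dir u i) :: real ^ 1 ^ 'n) ** (rowvector (unit_dir u i) :: real ^ 'n ^ 1))"

definition pt_S :: "real ^ 'n" where
  "pt_S = 0"

definition pt_A :: "('n \<Rightarrow> real ^ 'n) \<Rightarrow> 'n \<Rightarrow> real ^ 'n" where
  "pt_A u i = pt_S + u i"

definition pt_B :: "real \<Rightarrow> ('n \<Rightarrow> real ^ 'n) \<Rightarrow> 'n \<Rightarrow> real ^ 'n" where
  "pt_B l u i = pt_S + l *\<^sub>R u i"

definition pt_H :: "(real ^ 'n) set \<Rightarrow> ('n \<Rightarrow> real ^ 'n) \<Rightarrow> 'n \<Rightarrow> real ^ 'n" where
  "pt_H L u i = orth_proj L (pt_A u i)"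

end

theory Submission
  imports Defs
begin

text \<open>
  Both sides are sums over \<open>i\<close> of the same expression in the unit vectors \<open>e i = u i / norm (u i)\<close>.
  On the right, the trace of a matrix times a rank-one matrix is the value of the associated
  bilinear form, so \<open>trace (Q ** M)\<close> is the sum of the numbers \<open>Q (e i) \<bullet> e i\<close>
  (\<open>trace_proj_frame_operator\<close>).  On the left, \<open>Q x \<bullet> Q x = Q x \<bullet> x\<close> because \<open>x - Q x\<close> is
  orthogonal to \<open>Q x\<close>; expanding the square of \<open>norm (l *\<^sub>R x - Q x)\<close> therefore gives
  \<open>l\<^sup>2 * (x \<bullet> x) + (1 - 2 * l) * (Q x \<bullet> x)\<close> (\<open>dist_scale_orth_proj\<close>).  Dividing by the
  squared length of \<open>x = u i\<close> replaces \<open>x\<close> by \<open>e i\<close>, since both terms are quadratic in \<open>x\<close>.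
\<close>

text \<open>
  Cyclicity of the trace moves the row vector to the front, leaving the 1-by-1 matrix with entry
  \<open>w\<^sup>T A v\<close>; in coordinates both sides are the same double sum.
\<close>

lemma trace_matrix_mult_rank_one:
  fixes A :: "real ^ 'n ^ 'm" and v :: "real ^ 'n" and w :: "real ^ 'm"
  shows "trace (A ** ((columnvector v :: real ^ 1 ^ 'n) ** (rowvector w :: real ^ 'm ^ 1)))
    = (A *v v) \<bullet> w"
  by (simp add: trace_def matrix_matrix_mult_def matrix_vector_mult_def inner_vec_def
      columnvector_def rowvector_def sum_distrib_right mult.assoc)

lemma trace_matrix_mult_sum:
  fixes A :: "real ^ 'n ^ 'm" and B :: "'i \<Rightarrow> real ^ 'm ^ 'n"
  shows "trace (A ** (\<Sum>i\<in>I. B i)) = (\<Sum>i\<in>I. trace (A ** B i))"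
proof -
  have "linear (\<lambda>X :: real ^ 'm ^ 'n. trace (A ** X))"
    by (rule linearI)
      (simp_all add: matrix_add_ldistrib trace_add trace_def matrix_matrix_mult_def
        sum_distrib_left sum.distrib algebra_simps)
  then show ?thesis
    by (rule linear_sum)
qed

lemma trace_proj_frame_operator:
  fixes u :: "'n::finite \<Rightarrow> real ^ 'n"
  assumes "subspace L"
  shows "trace (proj_matrix L ** frame_operator u)
    = (\<Sum>i\<in>UNIV. orth_proj L (unit_dir u i) \<bullet> unit_dir u i)"
  using linear_orth_proj[OF assms]
  by (simp add: frame_operator_def proj_matrix_def trace_matrix_mult_sum
      trace_matrix_mult_rank_one matrix_works)

lemma orth_proj_unit_dir_inner:
  assumes "subspace L"
  shows "orth_proj L (unit_dir u i) \<bullet> unit_dir u i = (orth_proj L (u i) \<bullet> u i) / (norm (u i))\<^sup>2"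
  by (simp add: unit_dir_def linear_scale[OF linear_orth_proj[OF assms]] power2_eq_square
      field_simps)

text \<open>
  The coefficient \<open>1 - 2 * l\<close> collects two contributions: \<open>- 2 * l\<close> from the cross term and
  \<open>1\<close> from \<open>(norm (Q x))\<^sup>2\<close>, which is itself \<open>Q x \<bullet> x\<close>.
\<close>

lemma dist_scale_orth_proj:
  assumes "subspace L"
  shows "(dist (l *\<^sub>R x) (orth_proj L x))\<^sup>2
    = l\<^sup>2 * (norm x)\<^sup>2 + (1 - 2 * l) * (orth_proj L x \<bullet> x)"
proof -
  \<comment> \<open>\<open>x - Q x\<close> is orthogonal to all of \<open>L\<close>, in particular to \<open>Q x\<close>.\<close>
  have "orth_proj L x \<bullet> orth_proj L x = orth_proj L x \<bullet> x"
    using orth_proj_works(2)[OF assms orth_proj_works(1)[OF assms, of x], of x]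
    by (simp add: orthogonal_def inner_diff_left inner_commute[of x "orth_proj L x"])
  then show ?thesis
    unfolding dist_norm power2_norm_eq_inner
    by (simp add: inner_diff_left inner_diff_right inner_commute[of x "orth_proj L x"] power2_eq_square
        algebra_simps)
qed

theorem proposition2p3:
  fixes u :: "'n::finite \<Rightarrow> real ^ 'n"
    and L :: "(real ^ 'n) set"
    and l :: real
  assumes "\<And>i. u i \<noteq> 0"
    and "subspace L"
  shows "(\<Sum>i\<in>UNIV. (dist (pt_B l u i) (pt_H L u i))\<^sup>2 / (dist pt_S (pt_A u i))\<^sup>2)
    = real CARD('n) * l\<^sup>2 + (1 - 2 * l) * trace (proj_matrix L ** frame_operator u)"
proof -
  have term_eq: "(dist (pt_B l u i) (pt_H L u i))\<^sup>2 / (dist pt_S (pt_A u i))\<^sup>2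
      = l\<^sup>2 + (1 - 2 * l) * (orth_proj L (unit_dir u i) \<bullet> unit_dir u i)" for i
    using assms(1)[of i]
    by (simp add: pt_A_def pt_B_def pt_H_def pt_S_def dist_scale_orth_proj[OF assms(2)]
        orth_proj_unit_dir_inner[OF assms(2)] add_divide_distrib)
  show ?thesis
    by (simp add: term_eq sum.distrib trace_proj_frame_operator[OF assms(2)] sum_distrib_left)
qed

end
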